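(* Let $1\le k\le n$ be integers and let $\mathcal{Q}=\{S\subseteq[n]:|S|\le k\}$. Then $$\frac{n}{\sqrt{k}}\le \mathrm{val}_{\mathcal{Q}}\le \frac{2n}{\sqrt{k}}.$$
   Context: $[n]=\{1,\dots,n\}$, $\bar S=[n]\setminus S$. A function $f:\{-1,1\}^n\to\mathbb{R}$ is odd if $f(-x)=-f(x)$ for all $x$; $\|f\|_\infty=\max_x|f(x)|$. For $S\subseteq[n]$ and $b\in\{-1,1\}^{\bar S}$, $f_{S|b}:\{-1,1\}^S\to\mathbb{R}$ is the restriction of $f$ obtained by fixing the coordinates in $\bar S$ to $b$. $\mathrm{Var}(g)$ is the variance of $g(\mathbf{x})$ for $\mathbf{x}$ uniform on the domain of $g$. For $\mathcal{Q}\subseteq 2^{[n]}$, $$\mathrm{val}_{\mathcal{Q}} := \max_{\substack{f : \{-1,1\}^n \to \mathbb{R}\\ f \text{ odd},\ f\not\equiv 0}} \frac{\|f\|_\infty}{\max\limits_{S \in \mathcal{Q},\ b \in \{-1,1\}^{\bar{S}}}\sqrt{\mathrm{Var}(f_{S|b})}}.$$ *)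

theory Defs
  imports "HOL-Probability.Probability"
begin

definition cube :: "nat set \<Rightarrow> (nat \<Rightarrow> real) set" where
  "cube S = (S \<rightarrow>\<^sub>E {-1, 1})"

text \<open>
  A function on \<^term>\<open>cube {1..n}\<close> is represented by a total function on \<^typ>\<open>nat \<Rightarrow> real\<close>;
  everything below depends only on its values on \<^term>\<open>cube {1..n}\<close>. Negation is
  restricted to \<^term>\<open>{1..n}\<close> because points of the cube are extensional.
\<close>

definition odd_fun :: "nat \<Rightarrow> ((nat \<Rightarrow> real) \<Rightarrow> real) \<Rightarrow> bool" where
  "odd_fun n f \<longleftrightarrow> (\<forall>x\<in>cube {1..n}. f (\<lambda>i\<in>{1..n}. - x i) = - f x)"

definition sup_norm :: "nat \<Rightarrow> ((nat \<Rightarrow> real) \<Rightarrow> real) \<Rightarrow> real" where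
  "sup_norm n f = (MAX x\<in>cube {1..n}. \<bar>f x\<bar>)"

definition restr ::
  "nat \<Rightarrow> ((nat \<Rightarrow> real) \<Rightarrow> real) \<Rightarrow> nat set \<Rightarrow> (nat \<Rightarrow> real) \<Rightarrow> (nat \<Rightarrow> real) \<Rightarrow> real" where
  "restr n f S b = (\<lambda>x. f (merge S ({1..n} - S) (x, b)))"

definition Var :: "nat set \<Rightarrow> ((nat \<Rightarrow> real) \<Rightarrow> real) \<Rightarrow> real" where
  "Var S g = measure_pmf.variance (pmf_of_set (cube S)) g"

definition max_restr_sd :: "nat \<Rightarrow> nat set set \<Rightarrow> ((nat \<Rightarrow> real) \<Rightarrow> real) \<Rightarrow> real" where
  "max_restr_sd n Q f =
     Max {sqrt (Var S (restr n f S b)) | S b. S \<in> Q \<and> b \<in> cube ({1..n} - S)}"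

text \<open>
  The maximum over all functions is rendered by \<^const>\<open>Greatest\<close>, which is unspecified if
  the maximum is not attained.
\<close>

definition val :: "nat \<Rightarrow> nat set set \<Rightarrow> real" where
  "val n Q = (GREATEST r. \<exists>f. odd_fun n f \<and> (\<exists>x\<in>cube {1..n}. f x \<noteq> 0) \<and>
                 r = sup_norm n f / max_restr_sd n Q f)"

end

(* Lower bound: the sum of the coordinates. Upper bound: start from the mean of f over the
   whole cube, which is 0 since f is odd, and freeze the coordinates one at a time to their values
   in x. If S is the set of free coordinates and R is a subset of S with min(|S|, k) elements,
   Cauchy-Schwarz against the linear form with coefficients x_i on R (of variance |R|) shows that
   freezing an average coordinate of R increases the conditional mean by at most s / sqrt |R|,
   where s bounds the standard deviations of the restrictions. Some coordinate is at most average,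
   and the increments 1 / sqrt (min(m, k)) for m = 1..n add up to at most 2n / sqrt k. The maximum
   is attained by compactness. *)

theory Submission
  imports Defs
begin

section \<open>Averages over cubes\<close>

text \<open>A finite sum in place of the expectation under \<open>pmf_of_set (cube S)\<close>, so
  that linearity, conditioning and Cauchy-Schwarz reduce to facts about \<open>sum\<close>;
  \<open>Var_eq_avg\<close> links it to \<open>Var\<close>.\<close>

definition avg :: "nat set \<Rightarrow> ((nat \<Rightarrow> real) \<Rightarrow> real) \<Rightarrow> real" where
  "avg S g = (\<Sum>y\<in>cube S. g y) / 2 ^ card S"

lemma finite_cube [simp]: "finite S \<Longrightarrow> finite (cube S)"
  unfolding cube_def by (intro finite_PiE) auto

lemma cube_ne [simp]: "cube S \<noteq> {}"
  unfolding cube_def by (simp add: PiE_eq_empty_iff)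

lemma cube_empty [simp]: "cube {} = {\<lambda>_. undefined}"
  unfolding cube_def by simp

lemma card_cube: "finite S \<Longrightarrow> card (cube S) = 2 ^ card S"
  unfolding cube_def by (simp add: card_PiE numeral_2_eq_2)

lemma cubeD: "y \<in> cube S \<Longrightarrow> i \<in> S \<Longrightarrow> y i = -1 \<or> y i = 1"
  unfolding cube_def by (auto simp: PiE_iff)

lemma cube_square [simp]: "y \<in> cube S \<Longrightarrow> i \<in> S \<Longrightarrow> y i * y i = 1"
  using cubeD by fastforce

lemma cube_outside: "y \<in> cube S \<Longrightarrow> i \<notin> S \<Longrightarrow> y i = undefined"
  unfolding cube_def by (auto simp: PiE_iff extensional_def)

lemma restrict_in_cube:
  assumes "\<And>i. i \<in> S \<Longrightarrow> y i = -1 \<or> y i = 1"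
  shows "restrict y S \<in> cube S"
  using assms unfolding cube_def by (auto simp: PiE_iff)

lemma merge_in_cube:
  assumes "y \<in> cube S" "z \<in> cube T"
  shows "merge S T (y, z) \<in> cube (S \<union> T)"
  using assms unfolding cube_def by (auto simp: PiE_iff merge_def extensional_def)

lemma avg_cong: "(\<And>y. y \<in> cube S \<Longrightarrow> g y = h y) \<Longrightarrow> avg S g = avg S h"
  unfolding avg_def by (simp cong: sum.cong)

lemma avg_add: "avg S (\<lambda>y. g y + h y) = avg S g + avg S h"
  unfolding avg_def by (simp add: sum.distrib add_divide_distrib)

lemma avg_diff: "avg S (\<lambda>y. g y - h y) = avg S g - avg S h"
  unfolding avg_def by (simp add: sum_subtractf diff_divide_distrib)

lemma avg_cmult: "avg S (\<lambda>y. c * g y) = c * avg S g"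
  unfolding avg_def by (simp add: sum_distrib_left)

lemma avg_minus: "avg S (\<lambda>y. - g y) = - avg S g"
  using avg_cmult[of S "-1"] by simp

lemma avg_sum: "avg S (\<lambda>y. \<Sum>i\<in>I. g i y) = (\<Sum>i\<in>I. avg S (g i))"
  unfolding avg_def by (subst sum.swap) (simp add: sum_divide_distrib)

lemma avg_const: "finite S \<Longrightarrow> avg S (\<lambda>_. c) = c"
  unfolding avg_def by (simp add: card_cube)

lemma avg_mono: "(\<And>y. y \<in> cube S \<Longrightarrow> g y \<le> h y) \<Longrightarrow> avg S g \<le> avg S h"
  unfolding avg_def by (intro divide_right_mono sum_mono) auto

lemma avg_insert:
  assumes "finite S" "i \<notin> S"
  shows "avg (insert i S) g = (avg S (\<lambda>y. g (y(i := 1))) + avg S (\<lambda>y. g (y(i := -1)))) / 2"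
proof -
  have "(\<Sum>y\<in>cube (insert i S). g y) = (\<Sum>(c, y)\<in>{-1, 1} \<times> cube S. g (y(i := c)))"
    unfolding cube_def PiE_insert_eq
    by (subst sum.reindex) (use assms inj_combinator in \<open>auto simp: case_prod_unfold\<close>)
  also have "\<dots> = (\<Sum>y\<in>cube S. g (y(i := 1))) + (\<Sum>y\<in>cube S. g (y(i := -1)))"
    by (simp flip: sum.cartesian_product)
  finally show ?thesis
    using assms unfolding avg_def by (simp add: field_simps)
qed

text \<open>Fubini for the product of two cubes: \<open>merge\<close> and the pair of restrictions
  are mutually inverse because points of a cube are extensional.\<close>

lemma avg_Un:
  assumes "finite S" "finite T" "S \<inter> T = {}"
  shows "avg (S \<union> T) g = avg T (\<lambda>z. avg S (\<lambda>y. g (merge S T (y, z))))"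
proof -
  have "(\<Sum>(z, y)\<in>cube T \<times> cube S. g (merge S T (y, z))) = (\<Sum>w\<in>cube (S \<union> T). g w)"
  proof (rule sum.reindex_bij_witness[where
        i = "\<lambda>w. (restrict w T, restrict w S)" and j = "\<lambda>(z, y). merge S T (y, z)"])
    fix w assume "w \<in> cube (S \<union> T)"
    then show "(case (restrict w T, restrict w S) of (z, y) \<Rightarrow> merge S T (y, z)) = w"
      by (auto simp: merge_def fun_eq_iff dest: cube_outside)
    show "(restrict w T, restrict w S) \<in> cube T \<times> cube S"
      using \<open>w \<in> cube (S \<union> T)\<close> by (auto intro!: restrict_in_cube dest: cubeD)
  next
    fix p assume "p \<in> cube T \<times> cube S"
    then obtain z y where p: "p = (z, y)" "z \<in> cube T" "y \<in> cube S"
      by auto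
    then show "(case p of (z, y) \<Rightarrow> merge S T (y, z)) \<in> cube (S \<union> T)"
      by (simp add: merge_in_cube)
    have "restrict (merge S T (y, z)) T = z" "restrict (merge S T (y, z)) S = y"
      using p assms by (auto simp: restrict_def merge_def fun_eq_iff cube_outside)
    then show "(restrict (case p of (z, y) \<Rightarrow> merge S T (y, z)) T,
        restrict (case p of (z, y) \<Rightarrow> merge S T (y, z)) S) = p"
      using p by simp
  qed auto
  then show ?thesis
    using assms unfolding avg_def
    by (simp add: card_Un_disjoint power_add sum.cartesian_product flip: sum_divide_distrib)
qed

section \<open>Variance and linear forms on the cube\<close>

lemma Var_eq_avg:
  assumes "finite S"
  shows "Var S g = avg S (\<lambda>y. (g y - avg S g)\<^sup>2)"
  using assms unfolding Var_def avg_def by (simp add: integral_pmf_of_set card_cube)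

lemma Var_cong:
  assumes "finite S" "\<And>y. y \<in> cube S \<Longrightarrow> g y = h y"
  shows "Var S g = Var S h"
proof -
  have "avg S g = avg S h"
    using assms by (intro avg_cong)
  then show ?thesis
    using assms by (simp add: Var_eq_avg cong: avg_cong)
qed

lemma Var_cmult: "finite S \<Longrightarrow> Var S (\<lambda>y. c * g y) = c\<^sup>2 * Var S g"
  by (simp add: Var_eq_avg avg_cmult power_mult_distrib flip: right_diff_distrib)

lemma Var_nonneg: "finite S \<Longrightarrow> 0 \<le> Var S g"
  unfolding Var_eq_avg avg_def by (intro divide_nonneg_nonneg sum_nonneg) auto

lemma avg_coord:
  assumes "finite S" "i \<in> S"
  shows "avg S (\<lambda>y. y i) = 0"
proof -
  obtain R where "S = insert i R" "i \<notin> R"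
    using assms mk_disjoint_insert by metis
  then show ?thesis
    using assms by (simp add: avg_insert avg_const)
qed

text \<open>The coordinates are orthonormal: for distinct i and j, the values 1 and -1 of y i give
  contributions that cancel.\<close>

lemma avg_coord_mult:
  assumes "finite S" "i \<in> S" "j \<in> S"
  shows "avg S (\<lambda>y. y i * y j) = (if i = j then 1 else 0)"
proof (cases "i = j")
  case True
  then show ?thesis
    using assms by (simp add: avg_const cong: avg_cong)
next
  case False
  obtain R where R: "S = insert i R" "i \<notin> R"
    using assms mk_disjoint_insert by metis
  show ?thesis
    using assms R False by (simp add: avg_insert avg_minus)
qed

lemma avg_linear:
  assumes "finite S"
  shows "avg S (\<lambda>y. \<Sum>i\<in>S. a i * y i) = 0"
  using assms by (simp add: avg_sum avg_cmult avg_coord)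

lemma avg_linear_square:
  assumes "finite S"
  shows "avg S (\<lambda>y. (\<Sum>i\<in>S. a i * y i)\<^sup>2) = (\<Sum>i\<in>S. (a i)\<^sup>2)"
proof -
  have "avg S (\<lambda>y. (\<Sum>i\<in>S. a i * y i)\<^sup>2)
      = avg S (\<lambda>y. \<Sum>i\<in>S. \<Sum>j\<in>S. (a i * a j) * (y i * y j))"
    by (simp add: power2_eq_square sum_product algebra_simps)
  also have "\<dots> = (\<Sum>i\<in>S. \<Sum>j\<in>S. (a i * a j) * (if i = j then 1 else 0))"
    unfolding avg_sum avg_cmult using assms by (intro sum.cong) (simp_all add: avg_coord_mult)
  also have "\<dots> = (\<Sum>i\<in>S. (a i)\<^sup>2)"
    using assms by (simp add: if_distrib power2_eq_square sum.delta cong: if_cong)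
  finally show ?thesis .
qed

lemma Var_linear:
  assumes "finite S"
  shows "Var S (\<lambda>y. c + (\<Sum>i\<in>S. a i * y i)) = (\<Sum>i\<in>S. (a i)\<^sup>2)"
proof -
  have "avg S (\<lambda>y. c + (\<Sum>i\<in>S. a i * y i)) = c"
    by (simp only: avg_add avg_const[OF assms] avg_linear[OF assms] add_0_right)
  then show ?thesis
    using assms by (simp add: Var_eq_avg avg_linear_square)
qed

text \<open>Cauchy-Schwarz. The linear form has mean zero, so centring g leaves the left side
  unchanged; this is why the variance of g appears and not its second moment.\<close>

lemma avg_mult_linear_le:
  assumes S: "finite S"
  shows "avg S (\<lambda>y. g y * (\<Sum>i\<in>S. a i * y i)) \<le> sqrt (Var S g) * sqrt (\<Sum>i\<in>S. (a i)\<^sup>2)"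
proof -
  define l where "l y = (\<Sum>i\<in>S. a i * y i)" for y :: "nat \<Rightarrow> real"
  define h where "h y = g y - avg S g" for y
  have "avg S (\<lambda>y. h y * l y) = avg S (\<lambda>y. g y * l y)"
    unfolding h_def left_diff_distrib avg_diff avg_cmult
    using avg_linear[OF S] by (simp add: l_def)
  moreover have "(avg S (\<lambda>y. h y * l y))\<^sup>2 \<le> avg S (\<lambda>y. (h y)\<^sup>2) * avg S (\<lambda>y. (l y)\<^sup>2)"
    using Cauchy_Schwarz_ineq_sum[of h l "cube S"]
    by (simp add: avg_def power_divide divide_right_mono flip: power2_eq_square)
  ultimately have "(avg S (\<lambda>y. g y * l y))\<^sup>2 \<le> Var S g * (\<Sum>i\<in>S. (a i)\<^sup>2)"
    using S by (simp add: Var_eq_avg h_def l_def avg_linear_square)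
  then have "\<bar>avg S (\<lambda>y. g y * l y)\<bar> \<le> sqrt (Var S g * (\<Sum>i\<in>S. (a i)\<^sup>2))"
    by (intro real_le_rsqrt) simp
  then show ?thesis
    by (simp add: real_sqrt_mult l_def)
qed

text \<open>Variances are controlled only when R alone is free, so the average over S is split into
  slices with the coordinates of S - R fixed. On each slice Cauchy-Schwarz applies to the form with
  coefficients x i of square 1, whose variance is \<open>card R\<close>.\<close>

lemma sum_avg_coord_le:
  assumes S: "finite S" "R \<subseteq> S" and x: "\<And>i. i \<in> R \<Longrightarrow> (x i)\<^sup>2 = 1"
    and s: "\<And>z. z \<in> cube (S - R) \<Longrightarrow> sqrt (Var R (\<lambda>y. g (merge R (S - R) (y, z)))) \<le> s"
  shows "(\<Sum>i\<in>R. x i * avg S (\<lambda>y. g y * y i)) \<le> s * sqrt (card R)"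
proof -
  have R: "finite R" "finite (S - R)" "R \<inter> (S - R) = {}" "R \<union> (S - R) = S"
    using S finite_subset by auto
  have "(\<Sum>i\<in>R. x i * avg S (\<lambda>y. g y * y i)) = avg S (\<lambda>y. g y * (\<Sum>i\<in>R. x i * y i))"
    unfolding avg_cmult[symmetric] avg_sum[symmetric]
    by (simp add: sum_distrib_left algebra_simps)
  also have "\<dots> = avg (S - R) (\<lambda>z. avg R (\<lambda>y. g (merge R (S - R) (y, z)) * (\<Sum>i\<in>R. x i * y i)))"
    using avg_Un[OF R(1-3), of "\<lambda>y. g y * (\<Sum>i\<in>R. x i * y i)"] R(4)
    by (simp add: merge_def)
  also have "\<dots> \<le> avg (S - R) (\<lambda>_. s * sqrt (card R))"
  proof (rule avg_mono)
    fix z assume "z \<in> cube (S - R)"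
    then show "avg R (\<lambda>y. g (merge R (S - R) (y, z)) * (\<Sum>i\<in>R. x i * y i)) \<le> s * sqrt (card R)"
      using avg_mult_linear_le[OF R(1), of "\<lambda>y. g (merge R (S - R) (y, z))" x] s x
      by (fastforce intro: order_trans mult_right_mono)
  qed
  also have "\<dots> = s * sqrt (card R)"
    using R by (simp add: avg_const)
  finally show ?thesis .
qed

section \<open>The upper bound\<close>

lemma sum_inverse_sqrt_le:
  fixes k n :: nat
  assumes "1 \<le> k" "k \<le> n"
  shows "(\<Sum>m=1..n. 1 / sqrt (min m k)) \<le> 2 * n / sqrt k"
  using assms(2)
proof (induction n rule: dec_induct)
  case base
  \<comment> \<open>The induction starts at n = k. Up to there the minimum is m itself, and
    comparison with the telescoping sum of 2 (sqrt m - sqrt (m - 1)) gives 2 sqrt k = 2 k / sqrt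
    k.\<close>
  have "(\<Sum>m=1..j. 1 / sqrt (min m k)) \<le> 2 * sqrt j" if "j \<le> k" for j
    using that
  proof (induction j)
    case (Suc j)
    have "0 < sqrt (Suc j)"
      by simp
    have "1 = (sqrt (Suc j) - sqrt j) * (sqrt (Suc j) + sqrt j)"
      by (simp add: algebra_simps)
    also have "\<dots> \<le> (sqrt (Suc j) - sqrt j) * (2 * sqrt (Suc j))"
      by (intro mult_left_mono) auto
    finally have "1 \<le> 2 * (sqrt (Suc j) - sqrt j) * sqrt (Suc j)"
      by (simp only: mult_ac)
    then have "1 / sqrt (Suc j) \<le> 2 * (sqrt (Suc j) - sqrt j)"
      using \<open>0 < sqrt (Suc j)\<close> by (simp only: pos_divide_le_eq)
    then show ?case
      using Suc by (simp add: min_absorb1)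
  qed simp
  from this[of k] show ?case
    using assms(1) by (simp add: real_div_sqrt flip: times_divide_eq_right)
next
  case (step n)
  \<comment> \<open>Past k every summand is 1 / sqrt k, half of what the right side gains.\<close>
  then have "(\<Sum>m=1..Suc n. 1 / sqrt (min m k)) \<le> 2 * n / sqrt k + 1 / sqrt k"
    by (simp add: min_absorb2)
  also have "\<dots> \<le> 2 * Suc n / sqrt k"
    by (simp add: add_divide_distrib[symmetric] divide_right_mono)
  finally show ?case .
qed

text \<open>If A and B are the means with y i = 1 and y i = -1, then the mean is (A + B) / 2 and the
  correlation with y i is (A - B) / 2; adding or subtracting them gives A or B. The whole point x
  may serve as the fixed part, since \<open>merge\<close> reads it only off S.\<close>

lemma restr_fix_coordinate:
  assumes S: "finite S" "S \<subseteq> {1..n}" "i \<in> S" and x: "x \<in> cube {1..n}"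
  shows "avg (S - {i}) (restr n f (S - {i}) x)
    = avg S (restr n f S x) + x i * avg S (\<lambda>y. restr n f S x y * y i)"
proof -
  define R where "R = S - {i}"
  have R: "S = insert i R" "i \<notin> R" "finite R"
    using S by (auto simp: R_def)
  have "merge R ({1..n} - R) (y, x) = merge S ({1..n} - S) (y(i := x i), x)" for y
    using R S by (auto simp: merge_def fun_eq_iff)
  then have "avg R (restr n f R x) = avg R (\<lambda>y. restr n f S x (y(i := x i)))"
    by (simp add: restr_def)
  moreover have "x i = -1 \<or> x i = 1"
    using S x by (auto dest: cubeD)
  ultimately show ?thesis
    unfolding R_def[symmetric] unfolding R(1) avg_insert[OF R(3,2)]
    by (auto simp: avg_minus field_simps)
qed

lemma exists_le_average:
  fixes h :: "'a \<Rightarrow> real"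
  assumes "finite R" "R \<noteq> {}" "(\<Sum>i\<in>R. h i) \<le> s * sqrt (card R)"
  shows "\<exists>i\<in>R. h i \<le> s / sqrt (card R)"
proof (rule ccontr)
  assume "\<not> ?thesis"
  then have "(\<Sum>i\<in>R. s / sqrt (card R)) < (\<Sum>i\<in>R. h i)"
    using assms by (intro sum_strict_mono) auto
  moreover have "(\<Sum>i\<in>R. s / sqrt (card R)) = s * (card R / sqrt (card R))"
    by simp
  ultimately show False
    using assms by (simp add: real_div_sqrt del: sum_constant)
qed

text \<open>Induction on the number of free coordinates. The coordinate frozen next is not
  prescribed: it depends on f, x and the current S.\<close>

lemma value_le_avg:
  assumes s: "\<And>S b. S \<subseteq> {1..n} \<Longrightarrow> card S \<le> k \<Longrightarrow> b \<in> cube ({1..n} - S)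
      \<Longrightarrow> sqrt (Var S (restr n f S b)) \<le> s"
    and k: "1 \<le> k" and x: "x \<in> cube {1..n}" and S: "S \<subseteq> {1..n}"
  shows "f x \<le> avg S (restr n f S x) + s * (\<Sum>m=1..card S. 1 / sqrt (min m k))"
  using S
proof (induction "card S" arbitrary: S)
  case 0
  then have [simp]: "S = {}"
    using finite_subset by fastforce
  have "merge {} {1..n} (\<lambda>_. undefined, x) = x"
    using x by (auto simp: merge_def fun_eq_iff dest: cube_outside)
  then show ?case
    by (simp add: avg_def restr_def)
next
  case (Suc c)
  have S: "finite S" "S \<noteq> {}"
    using Suc.hyps(2) card.infinite by fastforce+
  \<comment> \<open>At most k elements, so that s bounds the restrictions to R; as many as possible,
    so that s / sqrt (card R) is small.\<close>
  obtain R where R: "R \<subseteq> S" "card R = min (card S) k"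
    using obtain_subset_with_card_n[of "min (card S) k" S] by auto
  then have fR: "finite R" "R \<noteq> {}"
    using S k Suc.hyps(2) finite_subset by fastforce+
  have "(\<Sum>i\<in>R. x i * avg S (\<lambda>y. restr n f S x y * y i)) \<le> s * sqrt (card R)"
  proof (rule sum_avg_coord_le[OF S(1) R(1)])
    show "(x i)\<^sup>2 = 1" if "i \<in> R" for i
      using that R Suc.prems x by (auto simp: power2_eq_square subset_iff)
  next
    fix z assume z: "z \<in> cube (S - R)"
    \<comment> \<open>A slice of a restriction is again a restriction of f: b takes z on S - R and x
      outside S, leaving R free.\<close>
    define b where "b = restrict (merge (S - R) ({1..n} - S) (z, x)) ({1..n} - R)"
    have "b \<in> cube ({1..n} - R)"
      unfolding b_def using z x Suc.prems
      by (intro restrict_in_cube) (auto simp: merge_def dest: cubeD)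
    then have "sqrt (Var R (restr n f R b)) \<le> s"
      using R Suc.prems by (intro s) auto
    moreover have "merge S ({1..n} - S) (merge R (S - R) (y, z), x) = merge R ({1..n} - R) (y, b)" for y
      using R Suc.prems by (auto simp: b_def merge_def fun_eq_iff)
    ultimately show "sqrt (Var R (\<lambda>y. restr n f S x (merge R (S - R) (y, z)))) \<le> s"
      by (simp add: restr_def)
  qed
  then obtain i where i: "i \<in> R"
    "x i * avg S (\<lambda>y. restr n f S x y * y i) \<le> s / sqrt (card R)"
    using exists_le_average[OF fR] by blast
  have "i \<in> S"
    using i R by auto
  then have "c = card (S - {i})"
    using Suc.hyps(2) S by simp
  then have "f x \<le> avg (S - {i}) (restr n f (S - {i}) x) + s * (\<Sum>m=1..c. 1 / sqrt (min m k))"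
    using Suc.hyps(1)[of "S - {i}"] Suc.prems by auto
  \<comment> \<open>The cost of freezing i is the summand for m = \<open>card S\<close>.\<close>
  also have "\<dots> \<le> avg S (restr n f S x) + s / sqrt (min (Suc c) k)
      + s * (\<Sum>m=1..c. 1 / sqrt (min m k))"
    using restr_fix_coordinate[OF S(1) Suc.prems \<open>i \<in> S\<close> x, of f] i R Suc.hyps(2) by simp
  also have "\<dots> = avg S (restr n f S x) + s * (\<Sum>m=1..card S. 1 / sqrt (min m k))"
    by (simp add: algebra_simps flip: Suc.hyps(2))
  finally show ?case .
qed

section \<open>Odd functions\<close>

lemma neg_in_cube: "x \<in> cube S \<Longrightarrow> (\<lambda>i\<in>S. - x i) \<in> cube S"
  by (rule restrict_in_cube) (auto dest: cubeD)

lemma neg_neg_cube: "x \<in> cube S \<Longrightarrow> (\<lambda>i\<in>S. - (\<lambda>i\<in>S. - x i) i) = x"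
  by (auto simp: fun_eq_iff restrict_def cube_outside)

lemma avg_odd:
  assumes "odd_fun n f"
  shows "avg {1..n} f = 0"
proof -
  have "(\<Sum>x\<in>cube {1..n}. f x) = (\<Sum>x\<in>cube {1..n}. - f x)"
    by (rule sum.reindex_bij_witness[where i = "\<lambda>x. \<lambda>i\<in>{1..n}. - x i"
          and j = "\<lambda>x. \<lambda>i\<in>{1..n}. - x i"])
      (use assms in \<open>simp_all only: neg_in_cube neg_neg_cube odd_fun_def minus_minus\<close>)
  then show ?thesis
    by (simp add: avg_def sum_negf)
qed

text \<open>With all coordinates free, \<open>value_le_avg\<close> starts from the mean 0 of an odd
  function. The resulting one-sided bound, taken at x and at its negative, bounds the absolute
  value.\<close>

lemma odd_fun_abs_le:
  assumes odd: "odd_fun n f" and k: "1 \<le> k" "k \<le> n"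
    and s: "\<And>S b. S \<subseteq> {1..n} \<Longrightarrow> card S \<le> k \<Longrightarrow> b \<in> cube ({1..n} - S)
      \<Longrightarrow> sqrt (Var S (restr n f S b)) \<le> s"
    and x: "x \<in> cube {1..n}"
  shows "\<bar>f x\<bar> \<le> s * (2 * n / sqrt k)"
proof -
  obtain b where "b \<in> cube ({1..n} - {})"
    using cube_ne by blast
  \<comment> \<open>The case S = {} of the hypothesis on s suffices.\<close>
  then have "0 \<le> s"
    using s[of "{}" b] Var_nonneg[of "{}"] by (fastforce intro: order_trans[rotated])
  have le: "f z \<le> s * (2 * n / sqrt k)" if z: "z \<in> cube {1..n}" for z
  proof -
    have "restr n f {1..n} z y = f y" if "y \<in> cube {1..n}" for y
    proof -
      have "merge {1..n} {} (y, z) = y"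
        using that by (auto simp: merge_def fun_eq_iff dest: cube_outside)
      then show ?thesis
        by (simp add: restr_def)
    qed
    then have "avg {1..n} (restr n f {1..n} z) = 0"
      using avg_odd[OF odd] avg_cong[of "{1..n}" "restr n f {1..n} z" f] by (simp only:)
    then have "f z \<le> s * (\<Sum>m=1..n. 1 / sqrt (min m k))"
      using value_le_avg[OF s k(1) z, of "{1..n}"] by simp
    also have "\<dots> \<le> s * (2 * n / sqrt k)"
      using sum_inverse_sqrt_le[OF k] \<open>0 \<le> s\<close> by (intro mult_left_mono) auto
    finally show ?thesis .
  qed
  have "f (\<lambda>i\<in>{1..n}. - x i) = - f x"
    using odd x by (simp only: odd_fun_def)
  then show ?thesis
    using le[OF x] le[OF neg_in_cube[OF x]] by (simp add: abs_le_iff)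
qed

section \<open>Attainment of the maximum\<close>

lemma sup_norm_ge: "x \<in> cube {1..n} \<Longrightarrow> \<bar>f x\<bar> \<le> sup_norm n f"
  unfolding sup_norm_def by (intro Max_ge) auto

lemma sup_norm_attained: "\<exists>x\<in>cube {1..n}. \<bar>f x\<bar> = sup_norm n f"
proof -
  have "sup_norm n f \<in> (\<lambda>x. \<bar>f x\<bar>) ` cube {1..n}"
    unfolding sup_norm_def by (intro Max_in) auto
  then show ?thesis
    by auto
qed

text \<open>As an image of a finite \<open>SIGMA\<close> set, the set of deviations is visibly
  finite, as the rules for \<open>Max\<close> require.\<close>

lemma max_restr_sd_eq_image:
  "max_restr_sd n Q f = Max ((\<lambda>(S, b). sqrt (Var S (restr n f S b))) ` (SIGMA S:Q. cube ({1..n} - S)))"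
  unfolding max_restr_sd_def by (rule arg_cong[of _ _ Max]) auto

lemma max_restr_sd_ge:
  assumes "finite Q" "S \<in> Q" "b \<in> cube ({1..n} - S)"
  shows "sqrt (Var S (restr n f S b)) \<le> max_restr_sd n Q f"
  unfolding max_restr_sd_eq_image using assms by (intro Max_ge) force+

lemma max_restr_sd_le:
  assumes "finite Q" "Q \<noteq> {}"
    and "\<And>S b. S \<in> Q \<Longrightarrow> b \<in> cube ({1..n} - S) \<Longrightarrow> sqrt (Var S (restr n f S b)) \<le> s"
  shows "max_restr_sd n Q f \<le> s"
  unfolding max_restr_sd_eq_image using assms by (subst Max_le_iff) (auto simp: Sigma_empty_iff)

text \<open>In the product topology on functions, the variance is a polynomial in finitely many
  evaluations of f.\<close>

lemma continuous_on_Var_restr: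
  assumes "finite S"
  shows "continuous_on A (\<lambda>f. Var S (restr n f S b))"
  unfolding Var_eq_avg[OF assms] avg_def restr_def
  by (intro continuous_intros continuous_on_subset[OF continuous_on_product_coordinates]) auto

text \<open>Tychonoff's theorem. It is applied to real functions on \<open>nat => real\<close>, an
  infinite index set although the cube is finite.\<close>

lemma compact_box:
  fixes I :: "'a \<Rightarrow> real set"
  assumes "\<And>x. compact (I x)"
  shows "compact {f. \<forall>x. f x \<in> I x}"
proof -
  have "compactin (product_topology (\<lambda>_. euclidean) UNIV) (PiE UNIV I)"
    using assms by (simp add: compactin_PiE)
  then show ?thesis
    by (simp add: euclidean_product_topology PiE_def Pi_def)
qed

text \<open>Functions are normalised to vanish off the cube, which confines the feasible set to a
  compact box.\<close>

lemma compact_normalised: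
  assumes k: "1 \<le> k" "k \<le> n"
  defines "Q \<equiv> {S. S \<subseteq> {1..n} \<and> card S \<le> k}"
  shows "compact {f. (\<forall>x. x \<notin> cube {1..n} \<longrightarrow> f x = 0) \<and> odd_fun n f
    \<and> (\<forall>S\<in>Q. \<forall>b\<in>cube ({1..n} - S). Var S (restr n f S b) \<le> 1)}" (is "compact ?K")
proof -
  \<comment> \<open>The upper bound already proved, for s = 1; it makes the feasible set bounded in
    every coordinate.\<close>
  define B where "B = 2 * n / sqrt k"
  let ?C = "cube {1..n}"
  have coord: "continuous_on UNIV (\<lambda>f :: (nat \<Rightarrow> real) \<Rightarrow> real. f x)" for x
    by simp
  have K: "?K = (\<Inter>x\<in>- ?C. {f. f x = 0}) \<inter> (\<Inter>x\<in>?C. {f. f (\<lambda>i\<in>{1..n}. - x i) = - f x})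
      \<inter> (\<Inter>S\<in>Q. \<Inter>b\<in>cube ({1..n} - S). {f. Var S (restr n f S b) \<le> 1})"
    by (auto simp: odd_fun_def)
  have "finite S" if "S \<in> Q" for S
    using that finite_subset by (auto simp: Q_def)
  then have "closed ?K"
    unfolding K
    by (intro closed_Int closed_INT ballI closed_Collect_eq closed_Collect_le
        continuous_on_Var_restr continuous_intros coord)
  moreover have "?K \<subseteq> {f. \<forall>x. f x \<in> {-B..B}}"
  proof clarify
    fix f x
    assume f: "\<forall>x. x \<notin> ?C \<longrightarrow> f x = 0" "odd_fun n f"
      "\<forall>S\<in>Q. \<forall>b\<in>cube ({1..n} - S). Var S (restr n f S b) \<le> 1"
    have "\<bar>f x\<bar> \<le> B"
    proof (cases "x \<in> ?C")
      case True
      then show ?thesis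
        using odd_fun_abs_le[OF f(2) k _ True, of 1] f(3) by (simp add: B_def Q_def)
    qed (use f in \<open>simp add: B_def\<close>)
    then show "f x \<in> {-B..B}"
      by (simp add: abs_le_iff)
  qed
  ultimately show ?thesis
    using compact_Int_closed[OF compact_box[of "\<lambda>_. {-B..B}"], of ?K] by (simp add: Int_absorb1)
qed

theorem theorem4p2:
  fixes n k :: nat
  assumes "1 \<le> k" and "k \<le> n"
  defines "Q \<equiv> {S. S \<subseteq> {1..n} \<and> card S \<le> k}"
  shows "real n / sqrt (real k) \<le> val n Q \<and> val n Q \<le> 2 * real n / sqrt (real k)"
proof -
  let ?C = "cube {1..n}"
  define K where "K = {f. (\<forall>x. x \<notin> ?C \<longrightarrow> f x = 0) \<and> odd_fun n f
    \<and> (\<forall>S\<in>Q. \<forall>b\<in>cube ({1..n} - S). Var S (restr n f S b) \<le> 1)}"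
  define P where "P r \<longleftrightarrow> (\<exists>f. odd_fun n f \<and> (\<exists>x\<in>?C. f x \<noteq> 0)
    \<and> r = sup_norm n f / max_restr_sd n Q f)" for r
  have Q: "finite Q" "Q \<noteq> {}"
    unfolding Q_def by (auto intro: exI[of _ "{}"])
  have finS: "finite S" if "S \<in> Q" for S
    using that finite_subset by (auto simp: Q_def)
  \<comment> \<open>A maximal deviation of at most 0 would force f x = 0 by the upper bound. Hence
    no quotient in \<open>P\<close> is a division by zero.\<close>
  have sd_pos: "0 < max_restr_sd n Q f" if f: "odd_fun n f" "x \<in> ?C" "f x \<noteq> 0" for f x
  proof (rule ccontr)
    assume "\<not> ?thesis"
    moreover have "\<bar>f x\<bar> \<le> max_restr_sd n Q f * (2 * n / sqrt k)"
      using odd_fun_abs_le[OF f(1) assms(1,2) _ f(2)] max_restr_sd_ge[OF Q(1)]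
      by (simp add: Q_def)
    ultimately have "\<bar>f x\<bar> \<le> 0"
      by (meson divide_nonneg_nonneg linorder_not_less mult_nonpos_nonneg mult_nonneg_nonneg
          of_nat_0_le_iff order_trans real_sqrt_ge_zero zero_le_numeral)
    then show False
      using f by simp
  qed

  have "compact K"
    unfolding K_def Q_def using compact_normalised[OF assms(1,2)] .
  \<comment> \<open>All values of |f x| with f in \<open>K\<close> and x in the cube form a finite
    union of continuous images of \<open>K\<close>, so a largest one exists.\<close>
  then have "compact (\<Union>x\<in>?C. (\<lambda>f. \<bar>f x\<bar>) ` K)"
    by (intro compact_UN finite_cube finite_atLeastAtMost compact_continuous_image continuous_intros
        continuous_on_subset[OF continuous_on_product_coordinates]) auto
  moreover have "(\<lambda>_. 0) \<in> K"
    using finS by (auto simp: K_def odd_fun_def restr_def Var_eq_avg avg_const)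
  ultimately obtain f0 x0 where f0: "f0 \<in> K" "x0 \<in> ?C"
    and max: "\<And>f x. f \<in> K \<Longrightarrow> x \<in> ?C \<Longrightarrow> \<bar>f x\<bar> \<le> \<bar>f0 x0\<bar>"
    using compact_attains_sup[of "\<Union>x\<in>?C. (\<lambda>f. \<bar>f x\<bar>) ` K"] cube_ne[of "{1..n}"] by fast
  have odd0: "odd_fun n f0"
    using f0 by (simp add: K_def)

  have P_le: "r \<le> \<bar>f0 x0\<bar>" if r: "P r" for r
  proof -
    obtain f y where f: "odd_fun n f" "y \<in> ?C" "f y \<noteq> 0" "r = sup_norm n f / max_restr_sd n Q f"
      using r unfolding P_def by blast
    define D where "D = max_restr_sd n Q f"
    \<comment> \<open>The quotient is invariant under scaling: dividing f by D makes all deviations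
      at most 1, and clearing the values off the cube puts the result in \<open>K\<close>.\<close>
    define g where "g x = (if x \<in> ?C then 1 / D * f x else 0)" for x
    have D: "0 < D"
      using sd_pos f by (simp add: D_def)
    have "Var S (restr n g S b) \<le> 1" if S: "S \<in> Q" "b \<in> cube ({1..n} - S)" for S b
    proof -
      have "S \<union> ({1..n} - S) = {1..n}"
        using S by (auto simp: Q_def)
      then have "restr n g S b y = 1 / D * restr n f S b y" if "y \<in> cube S" for y
        using merge_in_cube[OF that S(2)] by (simp add: restr_def g_def)
      then have "Var S (restr n g S b) = Var S (\<lambda>y. 1 / D * restr n f S b y)"
        using finS[OF S(1)] by (intro Var_cong)
      also have "\<dots> = Var S (restr n f S b) / D\<^sup>2"
        using finS[OF S(1)] by (simp only: Var_cmult) (simp add: power_divide)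
      also have "\<dots> \<le> 1"
        using max_restr_sd_ge[OF Q(1) S, of f] D sqrt_le_D by (simp add: D_def)
      finally show ?thesis .
    qed
    then have "g \<in> K"
      using f(1) neg_in_cube by (simp add: K_def odd_fun_def g_def)
    moreover obtain x where x: "x \<in> ?C" "\<bar>f x\<bar> = sup_norm n f"
      using sup_norm_attained by blast
    ultimately show ?thesis
      using max[of g x] D f(4) by (simp add: g_def D_def abs_mult)
  qed

  \<comment> \<open>The witness for the lower bound: its value at the all-ones point is n, and every
    restriction to S has variance \<open>card S\<close>, at most k.\<close>
  define lin where "lin x = (\<Sum>i=1..n. x i)" for x :: "nat \<Rightarrow> real"
  define one where "one = (\<lambda>i\<in>{1..n}. 1 :: real)"
  have one: "one \<in> ?C" "lin one = n"
    by (auto simp: one_def lin_def intro!: restrict_in_cube)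
  have lin: "odd_fun n lin"
    by (simp add: odd_fun_def lin_def sum_negf)
  have "Var S (restr n lin S b) \<le> k" if "S \<in> Q" for S b
  proof -
    have "restr n lin S b y = (\<Sum>i\<in>{1..n} - S. b i) + (\<Sum>i\<in>S. 1 * y i)" for y
    proof -
      have "lin z = sum z ({1..n} - S) + sum z S" for z
        unfolding lin_def using that by (intro sum.subset_diff) (auto simp: Q_def)
      then show ?thesis
        by (simp add: restr_def merge_def)
    qed
    then have "restr n lin S b = (\<lambda>y. (\<Sum>i\<in>{1..n} - S. b i) + (\<Sum>i\<in>S. 1 * y i))"
      by (rule ext)
    then show ?thesis
      using Var_linear[OF finS[OF that], of _ "\<lambda>_. 1"] that by (simp add: Q_def)
  qed
  then have "max_restr_sd n Q lin \<le> sqrt k"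
    by (intro max_restr_sd_le Q) simp
  moreover have "n \<le> sup_norm n lin"
    using sup_norm_ge[OF one(1), of lin] one(2) by simp
  moreover have nz: "lin one \<noteq> 0"
    using one(2) assms by simp
  moreover note sd_pos[OF lin one(1) nz]
  ultimately have "n / sqrt k \<le> sup_norm n lin / max_restr_sd n Q lin"
    by (intro frac_le) auto
  also have "\<dots> \<le> \<bar>f0 x0\<bar>"
    using lin one(1) nz by (intro P_le) (auto simp: P_def)
  finally have lower: "n / sqrt k \<le> \<bar>f0 x0\<bar>" .

  have "0 < n / sqrt k"
    using assms by simp
  \<comment> \<open>\<open>K\<close> contains the zero function, so it takes the lower bound to show
    that the maximiser is admissible in \<open>P\<close>.\<close>
  then have nz0: "f0 x0 \<noteq> 0"
    using lower by auto
  have "max_restr_sd n Q f0 \<le> 1"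
    using f0 by (intro max_restr_sd_le Q) (simp add: K_def)
  \<comment> \<open>The quotient of \<open>f0\<close> is at least |f0 x0| because its deviations are
    at most 1, and at most |f0 x0| by \<open>P_le\<close>; hence the maximum is attained and
    \<open>Greatest_equality\<close> applies.\<close>
  then have "\<bar>f0 x0\<bar> / 1 \<le> sup_norm n f0 / max_restr_sd n Q f0"
    using sd_pos[OF odd0 f0(2) nz0] sup_norm_ge[OF f0(2), of f0] by (intro frac_le) auto
  moreover have P0: "P (sup_norm n f0 / max_restr_sd n Q f0)"
    using odd0 f0 nz0 by (auto simp: P_def)
  ultimately have "P \<bar>f0 x0\<bar>"
    using P_le[OF P0] by simp
  then have "val n Q = \<bar>f0 x0\<bar>"
    unfolding val_def using P_le by (intro Greatest_equality) (simp_all only: P_def)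
  moreover have "\<bar>f0 x0\<bar> \<le> 2 * n / sqrt k"
    using odd_fun_abs_le[OF odd0 assms(1,2) _ f0(2), of 1] f0(1) by (simp add: K_def Q_def)
  ultimately show ?thesis
    using lower by simp
qed

end
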